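(* For every integer $k\ge 1$ there is a constant $c_k>0$ such that for every integer $n\ge 1$ there exists an $n$-point metric space $(X,d_X)$ with the following property: if $\mathcal{T}=\{T_1,\ldots,T_k\}$ is any $(\alpha,k)$-tree cover of $(X,d_X)$, then $\alpha\ge c_k\cdot n^{\frac{1}{2^{k-1}}}$. In other words, any size-$k$ tree cover of this metric has stretch $\Omega_k\big(n^{\frac{1}{2^{k-1}}}\big)$.
   Context: A tree on a finite set $X$ is a tree with vertex set $X$ whose edges carry positive real weights; $\mathrm{dist}_T(x,y)$ denotes the weighted shortest-path distance in $T$. Given a metric space $(X,d_X)$ with $|X|=n$, an $(\alpha,k)$-tree cover is a collection $\mathcal{T}=\{T_1,\ldots,T_k\}$ of $k$ edge-weighted trees on $X$ such that for every pair $x,y\in X$: (1) for each $1\le i\le k$, $\mathrm{dist}_{T_i}(x,y)\ge d_X(x,y)$ (each $T_i$ is a dominating tree); and (2) there exists $1\le i\le k$ with $\mathrm{dist}_{T_i}(x,y)\le \alpha\cdot d_X(x,y)$. The integer $k$ is the size and $\alpha\ge 1$ the stretch (distortion) of the tree cover. *)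

theory Defs
  imports "HOL-Analysis.Analysis"
begin

text \<open>
  Undirected simple graphs on a vertex set \<open>X\<close> are given by a set of two-element subsets of \<open>X\<close>;
  the weight function is relevant only on the edges. Walks and cycles are lists of vertices; the
  closing edge of a cycle joins the last vertex to the first one.
\<close>

record 'a wgraph =
  edges :: "'a set set"
  weight :: "'a set \<Rightarrow> real"

definition graph_on :: "'a set \<Rightarrow> ('a, 'm) wgraph_scheme \<Rightarrow> bool" where
  "graph_on X T \<longleftrightarrow> (\<forall>e \<in> edges T. \<exists>u\<in>X. \<exists>v\<in>X. u \<noteq> v \<and> e = {u, v})"

definition is_walk :: "'a set \<Rightarrow> ('a, 'm) wgraph_scheme \<Rightarrow> 'a list \<Rightarrow> bool" where
  "is_walk X T p \<longleftrightarrow>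
     p \<noteq> [] \<and> set p \<subseteq> X \<and> (\<forall>i. Suc i < length p \<longrightarrow> {p ! i, p ! Suc i} \<in> edges T)"

definition is_path_between :: "'a set \<Rightarrow> ('a, 'm) wgraph_scheme \<Rightarrow> 'a \<Rightarrow> 'a list \<Rightarrow> 'a \<Rightarrow> bool" where
  "is_path_between X T x p y \<longleftrightarrow> is_walk X T p \<and> distinct p \<and> hd p = x \<and> last p = y"

definition is_cycle :: "'a set \<Rightarrow> ('a, 'm) wgraph_scheme \<Rightarrow> 'a list \<Rightarrow> bool" where
  "is_cycle X T p \<longleftrightarrow>
     is_walk X T p \<and> distinct p \<and> 3 \<le> length p \<and> {last p, hd p} \<in> edges T"

definition connected_graph :: "'a set \<Rightarrow> ('a, 'm) wgraph_scheme \<Rightarrow> bool" where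
  "connected_graph X T \<longleftrightarrow> X \<noteq> {} \<and> (\<forall>x\<in>X. \<forall>y\<in>X. \<exists>p. is_path_between X T x p y)"

definition weighted_tree_on :: "'a set \<Rightarrow> ('a, 'm) wgraph_scheme \<Rightarrow> bool" where
  "weighted_tree_on X T \<longleftrightarrow>
     graph_on X T \<and> connected_graph X T \<and> (\<nexists>p. is_cycle X T p) \<and> (\<forall>e\<in>edges T. 0 < weight T e)"

definition walk_weight :: "('a, 'm) wgraph_scheme \<Rightarrow> 'a list \<Rightarrow> real" where
  "walk_weight T p = (\<Sum>i<length p - 1. weight T {p ! i, p ! Suc i})"

definition graph_dist :: "'a set \<Rightarrow> ('a, 'm) wgraph_scheme \<Rightarrow> 'a \<Rightarrow> 'a \<Rightarrow> real" where
  "graph_dist X T x y = Inf {walk_weight T p | p. is_path_between X T x p y}"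

definition tree_cover ::
  "'a set \<Rightarrow> ('a \<Rightarrow> 'a \<Rightarrow> real) \<Rightarrow> real \<Rightarrow> nat \<Rightarrow> (nat \<Rightarrow> 'a wgraph) \<Rightarrow> bool" where
  "tree_cover X d \<alpha> k T \<longleftrightarrow>
     1 \<le> \<alpha> \<and>
     (\<forall>i\<in>{1..k}. weighted_tree_on X (T i)) \<and>
     (\<forall>x\<in>X. \<forall>y\<in>X.
        (\<forall>i\<in>{1..k}. d x y \<le> graph_dist X (T i) x y) \<and>
        (\<exists>i\<in>{1..k}. graph_dist X (T i) x y \<le> \<alpha> * d x y))"

end

theory Submission
  imports Defs "HOL-Library.Function_Algebras"
begin

text \<open>
  The hard metric is the discrete torus \<open>(\<int>/m)\<^sup>D\<close> with \<open>D = 2 ^ (k - 1)\<close> and \<open>m\<close> about \<open>n powr (1/D)\<close>.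
  Since a tree has no cycles, each dominating tree lifts the torus to its universal cover \<open>\<int>\<^sup>D\<close>, and
  a pair whose tree distance is less than about \<open>m\<close> is lifted to a close pair. If the stretch is
  much smaller than \<open>m\<close>, the \<open>k\<close> lifts thus give \<open>k\<close> equivariant maps \<open>\<phi> a\<close> from \<open>\<int>\<^sup>D\<close> to the deck
  group (embedded in the reals) such that any two nearby points have the same image under at least
  one of them, i.e. \<open>(\<Prod>a<k. \<phi> a x - \<phi> a y) = 0\<close>.

  This product is a nondegenerate bilinear form in the vectors of the \<open>2 ^ k\<close> squarefree monomials in
  \<open>\<phi> a x\<close>, respectively \<open>\<phi> a y\<close>. So the vectors of the points near \<open>x\<close> span an isotropic subspace,
  whose dimension is between 1 and \<open>D\<close>. Among \<open>D + 1\<close> concentric boxes around \<open>x\<close> two consecutive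
  ones have the same span; its dimension colours \<open>x\<close> with one of \<open>D\<close> colours, and nearby points of the
  same colour have the same span. No two distinct lifts of a torus point share a span, so the torus
  would be covered by \<open>D\<close> sets that are inessential in the sense of Lusternik and Schnirelmann.
  Kuhn's combinatorial lemma excludes this.
\<close>

section \<open>Isotropic spans of monomial vectors\<close>

context vector_space
begin

text \<open>\<open>dim\<close> is the cardinality of a basis, which is 0 for an infinite one. The
  finite \<open>E\<close> forces the bases to be finite, even if the whole space is
  infinite-dimensional.\<close>

lemma dim_le_of_subset_span:
  assumes "finite E" "T \<subseteq> span E" "S \<subseteq> span T"
  shows "dim S \<le> dim T"
proof -
  obtain B where B: "B \<subseteq> T" "independent B" "T \<subseteq> span B" "card B = dim T"
    using basis_exists by blast
  have "finite B"
    using independent_span_bound[OF assms(1) B(2)] B(1) assms(2) by blast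
  moreover have "S \<subseteq> span B"
    using assms(3) span_minimal[OF B(3) subspace_span] by blast
  ultimately show ?thesis
    using dim_le_card B(4) by metis
qed

text \<open>A basis of \<open>S\<close> that failed to span \<open>T\<close> could be extended by a
  vector of \<open>T\<close> to an independent set with more than \<open>dim T\<close>
  elements.\<close>

lemma span_eq_of_dim_le:
  assumes "finite E" "T \<subseteq> span E" "S \<subseteq> span T" "dim T \<le> dim S"
  shows "span S = span T"
proof
  show "span S \<subseteq> span T"
    using span_minimal[OF assms(3) subspace_span] .
  obtain B where B: "B \<subseteq> S" "independent B" "S \<subseteq> span B" "card B = dim S"
    using basis_exists by blast
  have TE: "span T \<subseteq> span E"
    using span_minimal[OF assms(2) subspace_span] .
  have finB: "finite B"
    using independent_span_bound[OF assms(1) B(2)] B(1) assms(3) TE by blast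
  have "T \<subseteq> span B"
  proof (rule ccontr)
    assume "\<not> T \<subseteq> span B"
    then obtain t where t: "t \<in> T" "t \<notin> span B" by blast
    then have "t \<notin> B" using span_base by blast
    have ind: "independent (insert t B)"
      using t B(2) independent_insertI by blast
    have "insert t B \<subseteq> span T"
      using t(1) B(1) assms(3) span_base by blast
    then have "dim (insert t B) \<le> dim T"
      by (rule dim_le_of_subset_span[OF assms(1,2)])
    then show False
      using dim_eq_card_independent[OF ind] \<open>t \<notin> B\<close> finB B(4) assms(4) by simp
  qed
  then show "span T \<subseteq> span S"
    using span_minimal[OF _ subspace_span] span_mono[OF B(1)] by blast
qed

lemma independent_Un_if_span_disjoint:
  assumes A: "independent A" and B: "independent B" and AB: "span A \<inter> span B \<subseteq> {0}"
  shows "independent (A \<union> B)"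
proof -
  \<comment> \<open>The claim is asymmetric in \<open>A\<close> and \<open>B\<close>, and is applied
    in both orders below.\<close>
  have *: "a \<notin> span ((A \<union> B) - {a})"
    if A: "independent A" and AB: "span A \<inter> span B \<subseteq> {0}" and a: "a \<in> A" for A B a
  proof
    assume asm: "a \<in> span ((A \<union> B) - {a})"
    have "a \<noteq> 0" using A a dependent_zero by blast
    then have "a \<notin> B" using AB a span_base by blast
    then have "(A \<union> B) - {a} = (A - {a}) \<union> B" by blast
    then obtain u w where uw: "u \<in> span (A - {a})" "w \<in> span B" "a = u + w"
      using asm by (auto simp: span_Un)
    have "u \<in> span A" using uw(1) span_mono[of "A - {a}" A] by blast
    then have "a - u \<in> span A" using a span_base by (intro span_diff) auto
    then have "w = 0" using AB uw by auto
    then show False using A a uw dependent_def by auto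
  qed
  show ?thesis
    unfolding dependent_def
  proof
    assume "\<exists>a\<in>A \<union> B. a \<in> span (A \<union> B - {a})"
    then show False
      using *[OF A AB] *[of B A] B AB by (auto simp: Un_commute Int_commute)
  qed
qed

end

section \<open>Monomial vectors and their bilinear form\<close>

definition fscale :: "real \<Rightarrow> ('i \<Rightarrow> real) \<Rightarrow> 'i \<Rightarrow> real" where
  "fscale c f = (\<lambda>s. c * f s)"

global_interpretation fvs: vector_space fscale
  by standard (auto simp: fscale_def fun_eq_iff algebra_simps)

text \<open>The value 0 outside \<open>Pow {..<k}\<close> confines all these vectors to a coordinate
  space of dimension \<open>2 ^ k\<close>.\<close>

definition monomials :: "nat \<Rightarrow> (nat \<Rightarrow> real) \<Rightarrow> nat set \<Rightarrow> real" where
  "monomials k x S = (if S \<subseteq> {..<k} then \<Prod>a\<in>S. x a else 0)"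

definition unit_fun :: "'i \<Rightarrow> 'i \<Rightarrow> real" where
  "unit_fun s t = (if t = s then 1 else 0)"

lemma in_span_unit_fun:
  assumes "finite I" "\<And>s. s \<notin> I \<Longrightarrow> f s = 0"
  shows "f \<in> fvs.span (unit_fun ` I)"
proof -
  have "f t = (\<Sum>s\<in>I. fscale (f s) (unit_fun s)) t" for t
  proof -
    have "(\<Sum>s\<in>J. fscale (f s) (unit_fun s)) t = (\<Sum>s\<in>J. f s * unit_fun s t)" for J
      by (induction J rule: infinite_finite_induct) (auto simp: fscale_def)
    then show ?thesis
      using assms by (simp add: unit_fun_def if_distrib sum.delta cong: if_cong)
  qed
  then have "f = (\<Sum>s\<in>I. fscale (f s) (unit_fun s))" by blast
  also have "\<dots> \<in> fvs.span (unit_fun ` I)"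
    by (intro fvs.span_sum fvs.span_scale fvs.span_base) auto
  finally show ?thesis .
qed

lemma monomials_in_span: "monomials k ` A \<subseteq> fvs.span (unit_fun ` Pow {..<k})"
  by (intro image_subsetI in_span_unit_fun) (simp_all add: monomials_def)

text \<open>Entry \<open>S\<close> of the dual of \<open>monomials k y\<close> is the product of
  \<open>- y a\<close> over the complement of \<open>S\<close>: the cofactor of the monomial
  \<open>S\<close> in \<open>x\<close> when \<open>\<Prod>a<k. x a - y a\<close> is
  expanded.\<close>

definition dual :: "nat \<Rightarrow> (nat set \<Rightarrow> real) \<Rightarrow> nat set \<Rightarrow> real" where
  "dual k f S = (if S \<subseteq> {..<k} then (-1) ^ card ({..<k} - S) * f ({..<k} - S) else 0)"

definition pairing :: "nat \<Rightarrow> (nat set \<Rightarrow> real) \<Rightarrow> (nat set \<Rightarrow> real) \<Rightarrow> real" where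
  "pairing k f g = (\<Sum>S\<in>Pow {..<k}. f S * g S)"

lemma pairing_monomials_dual:
  "pairing k (monomials k x) (dual k (monomials k y)) = (\<Prod>a<k. x a - y a)"
proof -
  have "(\<Prod>a<k. x a - y a) = (\<Prod>a<k. x a + - y a)" by simp
  also have "\<dots> = (\<Sum>S\<in>Pow {..<k}. (\<Prod>a\<in>S. x a) * (\<Prod>a\<in>{..<k}-S. - y a))"
    by (rule prod_add) simp
  also have "\<dots> = pairing k (monomials k x) (dual k (monomials k y))"
    unfolding pairing_def by (rule sum.cong) (auto simp: monomials_def dual_def prod_uminus)
  finally show ?thesis by simp
qed

lemma linear_dual: "Vector_Spaces.linear fscale fscale (dual k)"
  by standard (auto simp: dual_def fscale_def fun_eq_iff algebra_simps)

lemma pairing_eq_0_on_spans: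
  assumes "\<And>f g. f \<in> A \<Longrightarrow> g \<in> B \<Longrightarrow> pairing k f g = 0"
    and "f \<in> fvs.span A" "g \<in> fvs.span B"
  shows "pairing k f g = 0"
proof -
  have 1: "pairing k f g = 0" if "f \<in> fvs.span A" "g \<in> B" for f g
    using that(1)
  proof (induction rule: fvs.span_induct)
    case base
    show ?case
      unfolding fvs.subspace_def
      by (auto simp: pairing_def fscale_def sum.distrib algebra_simps
          sum_distrib_left[symmetric])
  next
    case (step x)
    then show ?case using assms(1) that(2) by simp
  qed
  show ?thesis
    using assms(3)
  proof (induction rule: fvs.span_induct)
    case base
    show ?case
      unfolding fvs.subspace_def
      by (auto simp: pairing_def fscale_def sum.distrib algebra_simps
          sum_distrib_left[symmetric])
  next
    case (step x)
    then show ?case using 1 assms(2) by simp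
  qed
qed

text \<open>The span and its image under \<open>dual k\<close> are orthogonal for
  \<open>pairing\<close>, which is positive definite on vectors supported on
  \<open>Pow {..<k}\<close>, so they meet only in 0. They have equal dimension and share
  \<open>2 ^ k\<close> coordinates, so twice that dimension is at most \<open>2 ^ k\<close>.\<close>

lemma dim_isotropic_le:
  assumes "1 \<le> k" and iso: "\<And>x y. x \<in> A \<Longrightarrow> y \<in> A \<Longrightarrow> (\<Prod>a<k. x a - y a) = 0"
  shows "fvs.dim (monomials k ` A) \<le> 2 ^ (k - 1)"
proof -
  interpret dual: Vector_Spaces.linear fscale fscale "dual k" by (rule linear_dual)
  obtain B where B: "B \<subseteq> monomials k ` A" "fvs.independent B"
      "monomials k ` A \<subseteq> fvs.span B" "card B = fvs.dim (monomials k ` A)"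
    by (rule fvs.basis_exists)
  let ?E = "unit_fun ` Pow {..<k} :: (nat set \<Rightarrow> real) set"
  \<comment> \<open>\<open>dual k\<close> and \<open>pairing\<close> ignore the entries outside
    \<open>Pow {..<k}\<close>. That these vanish on the span gives injectivity of
    \<open>dual k\<close> and, at the end, \<open>f = 0\<close>.\<close>
  have supp: "f S = 0" if "f \<in> fvs.span B" "\<not> S \<subseteq> {..<k}" for f S
    using that(1)
  proof (induction rule: fvs.span_induct)
    case base
    show ?case by (auto simp: fvs.subspace_def fscale_def)
  next
    case (step x)
    then obtain z where "x = monomials k z" using B(1) by blast
    then show ?case using that(2) by (simp add: monomials_def)
  qed
  have "inj_on (dual k) (fvs.span B)"
  proof (rule inj_onI, rule ext)
    fix f g S assume f: "f \<in> fvs.span B" and g: "g \<in> fvs.span B" and eq: "dual k f = dual k g"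
    show "f S = g S"
    proof (cases "S \<subseteq> {..<k}")
      case True
      then have "{..<k} - ({..<k} - S) = S" by blast
      then show ?thesis using fun_cong[OF eq, of "{..<k} - S"] by (simp add: dual_def)
    next
      case False
      then show ?thesis using supp[OF f False] supp[OF g False] by simp
    qed
  qed
  then have indJ: "fvs.independent (dual k ` B)" and injJ: "inj_on (dual k) B"
    using dual.independent_injective_image[OF B(2)] inj_on_subset[OF _ fvs.span_superset]
    by auto
  have disj: "fvs.span B \<inter> fvs.span (dual k ` B) \<subseteq> {0}"
  proof
    fix f assume f: "f \<in> fvs.span B \<inter> fvs.span (dual k ` B)"
    \<comment> \<open>\<open>f\<close> lies in both of two mutually orthogonal spans, so it is
      orthogonal to itself, and a vanishing sum of squares vanishes termwise.\<close>
    have "pairing k f f = 0"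
    proof (rule pairing_eq_0_on_spans[of B "dual k ` B"])
      fix g h assume "g \<in> B" "h \<in> dual k ` B"
      then obtain x y where "x \<in> A" "g = monomials k x" "y \<in> A" "h = dual k (monomials k y)"
        using B(1) by blast
      then show "pairing k g h = 0"
        using iso by (simp add: pairing_monomials_dual)
    qed (use f in auto)
    then have "\<forall>S\<in>Pow {..<k}. f S * f S = 0"
      unfolding pairing_def by (subst sum_nonneg_eq_0_iff[symmetric]) auto
    then have "f S = 0" if "S \<subseteq> {..<k}" for S
      using that by auto
    moreover have "f S = 0" if "\<not> S \<subseteq> {..<k}" for S
      using supp[OF _ that, of f] f by (elim IntE)
    ultimately have "f = 0" by (intro ext, unfold zero_fun_apply) (rule case_split)
    then show "f \<in> {0}" by simp
  qed
  have ind: "fvs.independent (B \<union> dual k ` B)"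
    by (rule fvs.independent_Un_if_span_disjoint[OF B(2) indJ disj])
  have sub: "B \<union> dual k ` B \<subseteq> fvs.span ?E"
    using B(1) monomials_in_span[of k A]
    by (intro Un_least image_subsetI in_span_unit_fun) (auto simp: dual_def)
  have fin: "finite (B \<union> dual k ` B)" and le: "card (B \<union> dual k ` B) \<le> card ?E"
    using fvs.independent_span_bound[OF _ ind sub] by auto
  have "B \<inter> dual k ` B = {}"
  proof (rule ccontr)
    assume "B \<inter> dual k ` B \<noteq> {}"
    then obtain f where f: "f \<in> B" "f \<in> dual k ` B" by auto
    then have "f = 0" using disj fvs.span_base[OF f(1)] fvs.span_base[OF f(2)] by auto
    then show False using f(1) B(2) fvs.dependent_zero by auto
  qed
  then have "card (B \<union> dual k ` B) = 2 * card B"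
    using fin injJ by (simp add: card_Un_disjoint card_image)
  moreover have "card ?E \<le> 2 ^ k"
    using card_image_le[of "Pow {..<k}" unit_fun] by (simp add: card_Pow)
  moreover have "(2::nat) ^ k = 2 * 2 ^ (k - 1)"
    using assms(1) by (cases k) auto
  ultimately show ?thesis using le B(4) by linarith
qed

text \<open>Expanding a product of factors \<open>x a + t\<close> gives monomials in
  \<open>x\<close> with coefficients depending only on \<open>t\<close>, so adding \<open>t\<close>
  to every variable acts linearly on monomial vectors. Deck transformations will act this
  way.\<close>

definition translate :: "nat \<Rightarrow> real \<Rightarrow> (nat set \<Rightarrow> real) \<Rightarrow> nat set \<Rightarrow> real" where
  "translate k t f S = (if S \<subseteq> {..<k} then \<Sum>U\<in>Pow S. t ^ card (S - U) * f U else 0)"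

lemma translate_monomials: "translate k t (monomials k x) = monomials k (\<lambda>a. x a + t)"
proof
  fix S
  show "translate k t (monomials k x) S = monomials k (\<lambda>a. x a + t) S"
  proof (cases "S \<subseteq> {..<k}")
    case True
    then have fin: "finite S" using finite_subset by blast
    have "(\<Prod>a\<in>S. x a + t) = (\<Sum>U\<in>Pow S. (\<Prod>a\<in>U. x a) * (\<Prod>a\<in>S-U. t))"
      using fin by (rule prod_add)
    also have "\<dots> = (\<Sum>U\<in>Pow S. t ^ card (S - U) * monomials k x U)"
      using True by (intro sum.cong) (auto simp: monomials_def)
    finally show ?thesis using True fin by (simp add: translate_def monomials_def)
  qed (simp add: translate_def monomials_def)
qed

lemma linear_translate: "Vector_Spaces.linear fscale fscale (translate k t)"
  by standard (auto simp: translate_def fscale_def fun_eq_iff algebra_simps sum.distrib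
      sum_distrib_left)

lemma span_translate_monomials:
  "fvs.span (monomials k ` (\<lambda>x a. x a + t) ` A) = translate k t ` fvs.span (monomials k ` A)"
proof -
  interpret tr: Vector_Spaces.linear fscale fscale "translate k t" by (rule linear_translate)
  show ?thesis
    unfolding tr.span_image[symmetric] by (simp add: image_image translate_monomials)
qed

lemma dim_translate_monomials:
  "fvs.dim (monomials k ` (\<lambda>x a. x a + t) ` A) = fvs.dim (monomials k ` A)"
proof -
  have le: "fvs.dim (monomials k ` (\<lambda>x a. x a + t) ` A) \<le> fvs.dim (monomials k ` A)" for t A
  proof -
    obtain B where B: "B \<subseteq> monomials k ` A" "fvs.independent B"
        "monomials k ` A \<subseteq> fvs.span B" "card B = fvs.dim (monomials k ` A)"
      by (rule fvs.basis_exists)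
    have fin: "finite B"
      using fvs.independent_span_bound[OF _ B(2) order_trans[OF B(1) monomials_in_span]] by simp
    interpret tr: Vector_Spaces.linear fscale fscale "translate k t" by (rule linear_translate)
    have "monomials k ` (\<lambda>x a. x a + t) ` A = translate k t ` monomials k ` A"
      by (simp add: image_image translate_monomials)
    also have "\<dots> \<subseteq> fvs.span (translate k t ` B)"
      unfolding tr.span_image using B(3) by blast
    finally have "fvs.dim (monomials k ` (\<lambda>x a. x a + t) ` A) \<le> card (translate k t ` B)"
      using fin by (intro fvs.dim_le_card) auto
    also have "\<dots> \<le> card B" using fin by (rule card_image_le)
    finally show ?thesis using B(4) by simp
  qed
  \<comment> \<open>Translating back by \<open>- t\<close> turns the inequality into an
    equality.\<close>
  have "(\<lambda>x a. x a + - t) ` (\<lambda>x a. x a + t) ` A = A"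
    by (simp add: image_image)
  then show ?thesis
    using le[of t A] le[of "-t" "(\<lambda>x a. x a + t) ` A"] by simp
qed

section \<open>Inessential covers of the torus\<close>

text \<open>Each \<open>Rel j\<close> is a partial equivalence relation on lifts;
  \<open>Rel j x x\<close> means that \<open>x\<close> has colour \<open>j\<close>.
  \<open>free\<close> expresses that colours are inessential: no class joins two distinct lifts of a
  torus point. \<open>ext\<close> lets coordinates from \<open>D\<close> on vary freely.\<close>

locale torus_relation =
  fixes D :: nat and m :: int and Rel :: "nat \<Rightarrow> (nat \<Rightarrow> int) \<Rightarrow> (nat \<Rightarrow> int) \<Rightarrow> bool"
  assumes m_pos: "0 < m"
    and sym: "\<And>j x y. Rel j x y \<Longrightarrow> Rel j y x"
    and trans: "\<And>j x y z. Rel j x y \<Longrightarrow> Rel j y z \<Longrightarrow> Rel j x z"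
    and shift: "\<And>j x y v. Rel j x y \<Longrightarrow> Rel j (\<lambda>i. x i + m * v i) (\<lambda>i. y i + m * v i)"
    and free: "\<And>j x v i. Rel j x (\<lambda>i. x i + m * v i) \<Longrightarrow> i < D \<Longrightarrow> v i = 0"
    and ext: "\<And>j x y. Rel j x x \<Longrightarrow> (\<And>i. i < D \<Longrightarrow> x i = y i) \<Longrightarrow> Rel j x y"
    and near: "\<And>j x y. Rel j x x \<Longrightarrow> Rel j y y \<Longrightarrow> (\<And>i. i < D \<Longrightarrow> \<bar>x i - y i\<bar> \<le> 2) \<Longrightarrow> Rel j x y"
begin

text \<open>
  By freeness a class contains at most one lift of each torus point, hence is finite. The smallest
  \<open>j\<close>-th coordinate on the class of \<open>x\<close> is therefore an equivariant function of \<open>x\<close> that is constant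
  on classes.
\<close>

definition level :: "nat \<Rightarrow> (nat \<Rightarrow> int) \<Rightarrow> int" where
  "level j x = Min {y j | y. Rel j x y}"

lemma finite_level:
  assumes "j < D"
  shows "finite {y j | y. Rel j x y}"
proof -
  define res where "res y = map (\<lambda>i. y i mod m) [0..<D]" for y :: "nat \<Rightarrow> int"
  \<comment> \<open>A class is unrestricted in the coordinates from \<open>D\<close> on, so
    finiteness is claimed only for its \<open>j\<close>-th coordinates. By \<open>free\<close>,
    every member agrees there with the representative of its residues.\<close>
  define rep where "rep t = (SOME y. Rel j x y \<and> res y = t)" for t
  have "res ` {y. Rel j x y} \<subseteq> {t. set t \<subseteq> {0..<m} \<and> length t = D}"
    using m_pos by (auto simp: res_def)
  then have fin: "finite (res ` {y. Rel j x y})"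
    using finite_lists_length_eq[of "{0..<m}" D] finite_subset by blast
  have "{y j | y. Rel j x y} \<subseteq> (\<lambda>t. rep t j) ` res ` {y. Rel j x y}"
  proof clarify
    fix y assume y: "Rel j x y"
    define y' where "y' = rep (res y)"
    have y': "Rel j x y'" "res y' = res y"
      using someI[of "\<lambda>z. Rel j x z \<and> res z = res y" y] y unfolding y'_def rep_def by auto
    define v where "v i = (y' i - y i) div m" for i
    have "y' i mod m = y i mod m" if "i < D" for i
      using y'(2) that by (simp add: res_def)
    then have eq: "y' i = y i + m * v i" if "i < D" for i
      unfolding v_def using that by (simp add: mod_eq_dvd_iff)
    have "Rel j y' (\<lambda>i. y i + m * v i)"
      by (rule ext[OF trans[OF sym[OF y'(1)] y'(1)] eq])
    then have "Rel j y (\<lambda>i. y i + m * v i)"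
      by (rule trans[OF trans[OF sym[OF y] y'(1)]])
    then have "v j = 0" by (rule free[OF _ assms])
    then have "y j = rep (res y) j" using eq[OF assms] by (simp add: y'_def)
    then show "y j \<in> (\<lambda>t. rep t j) ` res ` {y. Rel j x y}" using y by blast
  qed
  then show ?thesis using fin finite_subset by blast
qed

lemma level_le: "j < D \<Longrightarrow> Rel j x x \<Longrightarrow> level j x \<le> x j"
  unfolding level_def by (rule Min_le[OF finite_level]) auto

lemma level_cong:
  assumes "Rel j x y" shows "level j x = level j y"
proof -
  have "Rel j x z \<longleftrightarrow> Rel j y z" for z
    using trans[OF assms] trans[OF sym[OF assms]] by (rule iffI[rotated])
  then show ?thesis by (simp add: level_def)
qed

lemma level_shift:
  assumes "j < D" "Rel j x x"
  shows "level j (\<lambda>i. x i + m * v i) = level j x + m * v j"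
proof -
  let ?s = "\<lambda>v x i. x i + m * v i :: int"
  have le: "level j (?s v x) \<le> level j x + m * v j" if x: "Rel j x x" for v x
  proof -
    have "level j x \<in> {y j | y. Rel j x y}"
      unfolding level_def by (rule Min_in[OF finite_level[OF assms(1)]]) (use x in auto)
    then obtain y where y: "Rel j x y" "level j x = y j" by blast
    have "y j + m * v j \<in> {z j | z. Rel j (?s v x) z}"
      using shift[OF y(1), of v] by (intro CollectI exI[of _ "?s v y"]) auto
    then have "level j (?s v x) \<le> y j + m * v j"
      unfolding level_def by (rule Min_le[OF finite_level[OF assms(1)]])
    then show ?thesis using y(2) by simp
  qed
  \<comment> \<open>The opposite shift supplies the reverse inequality.\<close>
  have "?s (\<lambda>i. - v i) (?s v x) = x" by auto
  then show ?thesis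
    using le[OF assms(2), of v] le[OF shift[OF assms(2), of v], of "\<lambda>i. - v i"] by simp
qed

text \<open>By \<open>level_shift\<close>, \<open>x j - level j x\<close> is invariant under the
  deck group, so a bound on the finite fundamental domain \<open>F\<close> suffices.\<close>

lemma level_bounded_below:
  "\<exists>M\<ge>0. \<forall>j<D. \<forall>x. Rel j x x \<longrightarrow> x j - M \<le> level j x"
proof -
  define F where "F = {x. \<forall>i. (i \<in> {..<D} \<longrightarrow> x i \<in> {0..<m}) \<and> (i \<notin> {..<D} \<longrightarrow> x i = (0::int))}"
  have finF: "finite F" unfolding F_def by (rule finite_set_of_finite_funs) auto
  define M where "M = (\<Sum>(j, x)\<in>{..<D} \<times> F. \<bar>x j - level j x\<bar>)"
  have "x j - M \<le> level j x" if "j < D" "Rel j x x" for j x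
  proof -
    define r where "r = (\<lambda>i. if i < D then x i mod m else 0)"
    define v where "v = (\<lambda>i. x i div m)"
    have rF: "r \<in> F" using m_pos by (auto simp: F_def r_def)
    have eq: "x i = r i + m * v i" if "i < D" for i using that by (simp add: r_def v_def)
    have "Rel j (\<lambda>i. x i + m * - v i) r" (is "Rel j ?x' r")
      by (rule ext[OF shift[OF that(2)]]) (use eq in auto)
    then have "Rel j r r" using trans[of j r ?x' r] sym[of j ?x' r] by blast
    have "Rel j x (\<lambda>i. r i + m * v i)"
      by (rule ext[OF that(2)]) (use eq in auto)
    then have "level j x = level j r + m * v j"
      using level_shift[OF that(1) \<open>Rel j r r\<close>] by (auto dest: level_cong)
    moreover have "\<bar>r j - level j r\<bar> \<le> M"
      unfolding M_def
      using member_le_sum[of "(j, r)" "{..<D} \<times> F" "\<lambda>(j, x). \<bar>x j - level j x\<bar>"] finF rF that(1)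
      by auto
    ultimately show ?thesis using eq[OF that(1)] by linarith
  qed
  moreover have "0 \<le> M" unfolding M_def by (rule sum_nonneg) auto
  ultimately show ?thesis by blast
qed

text \<open>Thresholding the levels gives a Kuhn labelling of a grid. Kuhn's lemma yields a cube on
  which every label component takes both values, but the component of a colour of the corner
  \<open>q\<close> is constant there.\<close>

theorem not_covering: "\<exists>x. \<forall>j<D. \<not> Rel j x x"
proof (rule ccontr)
  assume "\<not> ?thesis"
  then have cover: "\<exists>j<D. Rel j x x" for x by simp
  obtain M where M: "0 \<le> M" "\<forall>j<D. \<forall>x. Rel j x x \<longrightarrow> x j - M \<le> level j x"
    using level_bounded_below by (elim exE conjE)
  \<comment> \<open>A neighbour of a point with \<open>x j = 0\<close> has level at most 1. If
    \<open>x j = p\<close>, it has \<open>j\<close>-th coordinate at least \<open>M + 2\<close> and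
    hence level at least 2. This dictates the threshold 2 and the grid size.\<close>
  define p where "p = nat M + 3"
  define nb where "nb x j y \<longleftrightarrow> Rel j y y \<and> (\<forall>i<D. \<bar>int (x i) - y i\<bar> \<le> 1)" for x :: "nat \<Rightarrow> nat" and j y
  \<comment> \<open>Every point of a unit cube has a neighbour of colour \<open>j\<close> as soon as one corner has that colour,
    and then the \<open>j\<close>-th label is constant on the cube.\<close>
  define label :: "(nat \<Rightarrow> nat) \<Rightarrow> nat \<Rightarrow> nat" where
    "label x j = (if (\<exists>y. nb x j y \<and> 2 \<le> level j y) \<or> (\<nexists>y. nb x j y) \<and> x j = p then 1 else 0)" for x j
  have 0: "label x j = 0" if j: "j < D" and "x j = 0" for x j
  proof -
    have "level j y \<le> 1" if "nb x j y" for y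
    proof -
      have "\<bar>int (x j) - y j\<bar> \<le> 1" "Rel j y y" using that j by (auto simp: nb_def)
      then show ?thesis using level_le[OF j, of y] \<open>x j = 0\<close> by linarith
    qed
    then have "\<not> (nb x j y \<and> 2 \<le> level j y)" for y by fastforce
    then show ?thesis using that(2) by (simp add: label_def p_def)
  qed
  \<comment> \<open>If there is no neighbour of colour \<open>j\<close>, the second disjunct in
    \<open>label\<close> supplies the value 1 on this face.\<close>
  have 1: "label x j = 1" if j: "j < D" and "x j = p" for x j
  proof -
    have "2 \<le> level j y" if "nb x j y" for y
    proof -
      have "\<bar>int (x j) - y j\<bar> \<le> 1" "Rel j y y" using that j by (auto simp: nb_def)
      moreover have "int (x j) = M + 3" using \<open>x j = p\<close> M(1) by (simp add: p_def)
      ultimately show ?thesis using M(2)[rule_format, OF j, of y] by linarith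
    qed
    then show ?thesis using that by (auto simp: label_def)
  qed
  obtain q where q: "\<forall>i<D. \<exists>r s. (\<forall>j<D. q j \<le> r j \<and> r j \<le> q j + 1) \<and>
      (\<forall>j<D. q j \<le> s j \<and> s j \<le> q j + 1) \<and> label r i \<noteq> label s i"
  proof (rule kuhn_lemma[of p D label])
    show "0 < p" by (simp add: p_def)
    show "\<forall>x. (\<forall>i<D. x i \<le> p) \<longrightarrow> (\<forall>i<D. label x i = 0 \<or> label x i = 1)"
      by (simp add: label_def)
    show "\<forall>x. (\<forall>i<D. x i \<le> p) \<longrightarrow> (\<forall>i<D. x i = 0 \<longrightarrow> label x i = 0)"
      using 0 by blast
    show "\<forall>x. (\<forall>i<D. x i \<le> p) \<longrightarrow> (\<forall>i<D. x i = p \<longrightarrow> label x i = 1)"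
      using 1 by blast
  qed
  obtain j where j: "j < D" "Rel j (\<lambda>i. int (q i)) (\<lambda>i. int (q i))"
    using cover[of "\<lambda>i. int (q i)"] by (elim exE conjE)
  have "label r j = (if 2 \<le> level j (\<lambda>i. int (q i)) then 1 else 0)"
    if r: "\<And>i. i < D \<Longrightarrow> q i \<le> r i \<and> r i \<le> q i + 1" for r
  proof -
    have "\<bar>int (r i) - int (q i)\<bar> \<le> 1" if "i < D" for i
      using r[OF that] by linarith
    then have q: "nb r j (\<lambda>i. int (q i))"
      using j by (auto simp: nb_def)
    \<comment> \<open>\<open>y\<close> is within 1 of \<open>r\<close>, and \<open>r\<close> within
      1 of \<open>q\<close>; this is where the distance 2 in \<open>near\<close> comes from.\<close>
    have level: "level j y = level j (\<lambda>i. int (q i))" if y: "nb r j y" for y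
    proof (rule level_cong, rule near)
      show "Rel j y y" using y by (simp add: nb_def)
      show "\<bar>y i - int (q i)\<bar> \<le> 2" if "i < D" for i
      proof -
        have "\<bar>int (r i) - y i\<bar> \<le> 1" using y that by (simp add: nb_def)
        then show ?thesis using r[OF that] by linarith
      qed
    qed (use j in simp)
    have "(\<exists>y. nb r j y \<and> 2 \<le> level j y) \<longleftrightarrow> 2 \<le> level j (\<lambda>i. int (q i))"
    proof
      assume "\<exists>y. nb r j y \<and> 2 \<le> level j y"
      then obtain y where "nb r j y" "2 \<le> level j y" by blast
      then show "2 \<le> level j (\<lambda>i. int (q i))" using level[of y] by simp
    qed (use q in blast)
    moreover have "\<not> (\<nexists>y. nb r j y)" using q by blast
    ultimately show ?thesis unfolding label_def by presburger
  qed
  moreover obtain r s where "\<forall>i<D. q i \<le> r i \<and> r i \<le> q i + 1"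
      "\<forall>i<D. q i \<le> s i \<and> s i \<le> q i + 1" "label r j \<noteq> label s j"
    using q j(1) by blast
  ultimately show False by simp
qed

end

section \<open>Equivariant maps on the universal cover\<close>

text \<open>\<open>\<tau>\<close> stands for an embedding of the deck group into the reals, and each
  \<open>\<phi> a\<close> comes from one tree. The largest box has radius \<open>2 * D\<close>, so
  any two of its points satisfy the bound in \<open>agree\<close>.\<close>

locale equivariant_maps =
  fixes k D :: nat and m :: int and \<phi> :: "nat \<Rightarrow> (nat \<Rightarrow> int) \<Rightarrow> real" and \<tau> :: "(nat \<Rightarrow> int) \<Rightarrow> real"
  assumes k_pos: "1 \<le> k" and D_def: "D = 2 ^ (k - 1)" and m_pos: "0 < m"
    and equivariant: "\<And>a x v. \<phi> a (\<lambda>i. x i + m * v i) = \<phi> a x + \<tau> v"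
    and \<tau>_eq_0D: "\<And>v i. \<tau> v = 0 \<Longrightarrow> i < D \<Longrightarrow> v i = 0"
    and agree: "\<And>x y. (\<And>i. i < D \<Longrightarrow> \<bar>x i - y i\<bar> \<le> 4 * int D) \<Longrightarrow> \<exists>a<k. \<phi> a x = \<phi> a y"
begin

text \<open>The radius grows in steps of 2, the distance in \<open>near\<close>, so that moving to a
  near centre costs one step.\<close>

definition box :: "(nat \<Rightarrow> int) \<Rightarrow> nat \<Rightarrow> (nat \<Rightarrow> int) set" where
  "box x l = {y. \<forall>i<D. \<bar>y i - x i\<bar> \<le> 2 * int l}"

definition vecs :: "(nat \<Rightarrow> int) \<Rightarrow> nat \<Rightarrow> (nat set \<Rightarrow> real) set" where
  "vecs x l = monomials k ` (\<lambda>y a. \<phi> a y) ` box x l"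

text \<open>Dimensions range from 1 to \<open>D\<close> while colours start at 0, hence
  \<open>Suc j\<close>. Equality of two consecutive spans absorbs a change of centre.\<close>

definition label :: "nat \<Rightarrow> (nat \<Rightarrow> int) \<Rightarrow> (nat set \<Rightarrow> real) set \<Rightarrow> bool" where
  "label j x W \<longleftrightarrow>
     (\<exists>l<D. fvs.span (vecs x l) = W \<and> fvs.span (vecs x (Suc l)) = W \<and> fvs.dim W = Suc j)"

definition same_label :: "nat \<Rightarrow> (nat \<Rightarrow> int) \<Rightarrow> (nat \<Rightarrow> int) \<Rightarrow> bool" where
  "same_label j x y \<longleftrightarrow> (\<exists>W. label j x W \<and> label j y W)"

lemma vecs_in_span: "vecs x l \<subseteq> fvs.span (unit_fun ` Pow {..<k})"
  unfolding vecs_def by (rule monomials_in_span)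

lemmas vecs_dim_mono = fvs.dim_le_of_subset_span[OF _ vecs_in_span, simplified]
lemmas vecs_span_eq = fvs.span_eq_of_dim_le[OF _ vecs_in_span, simplified]

lemma isotropic:
  assumes "y \<in> box x l" "z \<in> box x l" "l \<le> D"
  shows "(\<Prod>a<k. \<phi> a y - \<phi> a z) = 0"
proof -
  have "\<bar>y i - z i\<bar> \<le> 4 * int D" if "i < D" for i
  proof -
    have "\<bar>y i - x i\<bar> \<le> 2 * int l" "\<bar>z i - x i\<bar> \<le> 2 * int l"
      using assms(1,2) that by (auto simp: box_def)
    then show ?thesis using assms(3) by linarith
  qed
  then obtain a where "a < k" "\<phi> a y = \<phi> a z" using agree by blast
  then show ?thesis by (intro prod_zero) auto
qed

lemma dim_vecs_le:
  assumes "l \<le> D"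
  shows "fvs.dim (vecs x l) \<le> D"
proof -
  have "fvs.dim (vecs x l) \<le> 2 ^ (k - 1)"
    unfolding vecs_def by (rule dim_isotropic_le[OF k_pos]) (use isotropic[OF _ _ assms] in blast)
  then show ?thesis by (simp add: D_def)
qed

lemma self_in_vecs: "monomials k (\<lambda>a. \<phi> a x) \<in> vecs x l"
  by (auto simp: vecs_def box_def)

text \<open>The empty product makes the entry at \<open>{}\<close> equal to 1, so no monomial vector
  vanishes.\<close>

lemma dim_vecs_pos: "1 \<le> fvs.dim (vecs x l)"
proof -
  let ?f = "monomials k (\<lambda>a. \<phi> a x)"
  have "?f {} = 1" by (simp add: monomials_def)
  then have "?f \<noteq> 0" by (metis zero_fun_apply zero_neq_one)
  then have "fvs.dim {?f} = 1"
    using fvs.dim_eq_card_independent[of "{?f}"] by simp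
  moreover have "{?f} \<subseteq> fvs.span (vecs x l)"
    using self_in_vecs fvs.span_base by auto
  ultimately show ?thesis using vecs_dim_mono by metis
qed

lemma vecs_mono: "l \<le> l' \<Longrightarrow> vecs x l \<subseteq> vecs x l'"
  unfolding vecs_def box_def by (intro image_mono) fastforce

text \<open>The boxes of index 0 to \<open>D\<close> have dimensions between 1 and \<open>D\<close>,
  so at some step the dimension does not grow, and nested spans of equal dimension coincide.\<close>

lemma label_exists: "\<exists>j<D. \<exists>W. label j x W"
proof -
  have "\<exists>l<D. fvs.dim (vecs x (Suc l)) \<le> fvs.dim (vecs x l)"
  proof (rule ccontr)
    assume "\<not> ?thesis"
    then have inc: "fvs.dim (vecs x l) < fvs.dim (vecs x (Suc l))" if "l < D" for l
      using that by (meson not_le)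
    have "l \<le> D \<Longrightarrow> l + 1 \<le> fvs.dim (vecs x l)" for l
    proof (induction l)
      case 0
      then show ?case using dim_vecs_pos by simp
    next
      case (Suc l)
      then show ?case using inc[of l] by simp
    qed
    then show False using dim_vecs_le[of D x] by fastforce
  qed
  then obtain l where l: "l < D" "fvs.dim (vecs x (Suc l)) \<le> fvs.dim (vecs x l)" by blast
  have "vecs x l \<subseteq> fvs.span (vecs x (Suc l))"
    using vecs_mono[of l "Suc l" x] fvs.span_superset by fastforce
  then have "fvs.span (vecs x l) = fvs.span (vecs x (Suc l))"
    using l(2) by (rule vecs_span_eq)
  moreover obtain j where "fvs.dim (vecs x l) = Suc j" "j < D"
    using dim_vecs_pos[of x l] dim_vecs_le[of l x] l(1)
    by (cases "fvs.dim (vecs x l)") auto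
  ultimately have "label j x (fvs.span (vecs x l))" "j < D"
    unfolding label_def using l(1) fvs.dim_span[of "vecs x l"] by auto
  then show ?thesis by blast
qed

text \<open>If \<open>l \<le> l'\<close>, the box of index \<open>l\<close> around \<open>x\<close>
  lies in the one of index \<open>Suc l'\<close> around \<open>y\<close>. So the two spans are
  nested, and both have dimension \<open>Suc j\<close>.\<close>

lemma label_near_eq:
  assumes "label j x W" "label j y W'" and near: "\<And>i. i < D \<Longrightarrow> \<bar>x i - y i\<bar> \<le> 2"
  shows "W = W'"
proof -
  have *: "fvs.span (vecs x l) = fvs.span (vecs y (Suc l'))"
    if "l \<le> l'" and near: "\<And>i. i < D \<Longrightarrow> \<bar>x i - y i\<bar> \<le> 2"
      and dim: "fvs.dim (vecs y (Suc l')) \<le> fvs.dim (vecs x l)" for x y l l'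
  proof (rule vecs_span_eq[OF _ dim])
    have "box x l \<subseteq> box y (Suc l')"
    proof
      fix z assume z: "z \<in> box x l"
      have "\<bar>z i - y i\<bar> \<le> 2 * int (Suc l')" if "i < D" for i
      proof -
        have "\<bar>z i - x i\<bar> \<le> 2 * int l" using z that by (simp add: box_def)
        then show ?thesis using near[OF that] \<open>l \<le> l'\<close> by simp
      qed
      then show "z \<in> box y (Suc l')" by (simp add: box_def)
    qed
    then have "vecs x l \<subseteq> vecs y (Suc l')"
      unfolding vecs_def by (intro image_mono)
    then show "vecs x l \<subseteq> fvs.span (vecs y (Suc l'))"
      using fvs.span_superset by fastforce
  qed
  obtain l where l: "fvs.span (vecs x l) = W" "fvs.span (vecs x (Suc l)) = W" "fvs.dim W = Suc j"
    using assms(1) by (auto simp: label_def)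
  obtain l' where l': "fvs.span (vecs y l') = W'" "fvs.span (vecs y (Suc l')) = W'"
      "fvs.dim W' = Suc j"
    using assms(2) by (auto simp: label_def)
  have dims: "fvs.dim (vecs x l) = Suc j" "fvs.dim (vecs x (Suc l)) = Suc j"
      "fvs.dim (vecs y l') = Suc j" "fvs.dim (vecs y (Suc l')) = Suc j"
    using l l' fvs.dim_span by metis+
  show ?thesis
  proof (cases "l \<le> l'")
    case True
    then show ?thesis using *[OF True near] dims l l' by simp
  next
    case False
    then have "l' \<le> l" by simp
    moreover have "\<bar>y i - x i\<bar> \<le> 2" if "i < D" for i
      using near[OF that] by linarith
    ultimately show ?thesis using *[of l' l y x] dims l l' by simp
  qed
qed

lemma vecs_shift:
  "vecs (\<lambda>i. x i + m * v i) l = monomials k ` (\<lambda>p a. p a + \<tau> v) ` (\<lambda>y a. \<phi> a y) ` box x l"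
proof -
  have "box (\<lambda>i. x i + m * v i) l = (\<lambda>y i. y i + m * v i) ` box x l"
  proof (intro equalityI subsetI)
    fix z assume "z \<in> box (\<lambda>i. x i + m * v i) l"
    then have "(\<lambda>i. z i - m * v i) \<in> box x l"
      by (simp add: box_def algebra_simps)
    then show "z \<in> (\<lambda>y i. y i + m * v i) ` box x l"
      by (rule rev_image_eqI) auto
  qed (auto simp: box_def)
  then show ?thesis
    by (simp add: vecs_def image_image equivariant)
qed

lemma label_shift:
  assumes "label j x W"
  shows "label j (\<lambda>i. x i + m * v i) (translate k (\<tau> v) ` W)"
proof -
  obtain l where l: "l < D" "fvs.span (vecs x l) = W" "fvs.span (vecs x (Suc l)) = W"
      "fvs.dim W = Suc j"
    using assms by (auto simp: label_def)
  have span: "fvs.span (vecs (\<lambda>i. x i + m * v i) l) = translate k (\<tau> v) ` fvs.span (vecs x l)" for l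
    unfolding vecs_shift span_translate_monomials by (simp add: vecs_def)
  moreover have "fvs.dim (vecs (\<lambda>i. x i + m * v i) l) = fvs.dim (vecs x l)"
    unfolding vecs_shift dim_translate_monomials by (simp add: vecs_def)
  then have "fvs.dim (translate k (\<tau> v) ` W) = Suc j"
    using span[of l] l fvs.dim_span by metis
  ultimately show ?thesis using l by (auto simp: label_def)
qed

text \<open>\<open>W\<close> is isotropic and contains the vectors of both lifts, whose pairing is a
  product of \<open>k\<close> factors \<open>- \<tau> v\<close>.\<close>

lemma label_free:
  assumes "label j x W" "label j (\<lambda>i. x i + m * v i) W"
  shows "\<tau> v = 0"
proof -
  interpret dual: Vector_Spaces.linear fscale fscale "dual k" by (rule linear_dual)
  obtain l where l: "l < D" "fvs.span (vecs x l) = W"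
    using assms(1) by (auto simp: label_def)
  have mem: "monomials k (\<lambda>a. \<phi> a y) \<in> W" if "label j y W" for y
    using that self_in_vecs[of y] fvs.span_base by (auto simp: label_def)
  let ?f = "monomials k (\<lambda>a. \<phi> a x)" and ?g = "monomials k (\<lambda>a. \<phi> a x + \<tau> v)"
  have "pairing k ?f (dual k ?g) = 0"
  proof (rule pairing_eq_0_on_spans[of "vecs x l" "dual k ` vecs x l"])
    fix f g assume "f \<in> vecs x l" "g \<in> dual k ` vecs x l"
    then obtain y z where "y \<in> box x l" "f = monomials k (\<lambda>a. \<phi> a y)"
        "z \<in> box x l" "g = dual k (monomials k (\<lambda>a. \<phi> a z))"
      by (auto simp: vecs_def)
    then show "pairing k f g = 0"
      using isotropic[of y x l z] l(1) by (simp add: pairing_monomials_dual)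
  next
    show "?f \<in> fvs.span (vecs x l)" using mem[OF assms(1)] l(2) by simp
    show "dual k ?g \<in> fvs.span (dual k ` vecs x l)"
      unfolding dual.span_image using mem[OF assms(2)] l(2) by (simp add: equivariant)
  qed
  then have "(\<Prod>a<k. - \<tau> v) = 0" by (simp add: pairing_monomials_dual)
  then show ?thesis by simp
qed

theorem inconsistent: False
proof -
  have ext: "label j x W \<longleftrightarrow> label j y W" if "\<And>i. i < D \<Longrightarrow> x i = y i" for j x y W
  proof -
    have "box x = box y" using that by (auto simp: box_def fun_eq_iff)
    then show ?thesis by (simp add: label_def vecs_def)
  qed
  interpret torus_relation D m same_label
  proof
    show "0 < m" by (rule m_pos)
  next
    fix j x y assume "same_label j x y"
    then show "same_label j y x" by (auto simp: same_label_def)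
  next
    fix j x y z assume "same_label j x y" "same_label j y z"
    then obtain W W' where "label j x W" "label j y W" "label j y W'" "label j z W'"
      by (auto simp: same_label_def)
    \<comment> \<open>A point is near itself, so its colour determines its span.\<close>
    moreover from this have "W = W'" using label_near_eq[of j y W y W'] by simp
    ultimately show "same_label j x z" by (auto simp: same_label_def)
  next
    fix j x y v assume "same_label j x y"
    then show "same_label j (\<lambda>i. x i + m * v i) (\<lambda>i. y i + m * v i)"
      unfolding same_label_def using label_shift by blast
  next
    fix j x v i assume "same_label j x (\<lambda>i. x i + m * v i)" "i < D"
    then show "v i = 0" using label_free \<tau>_eq_0D unfolding same_label_def by blast
  next
    fix j x y assume "same_label j x x" "\<And>i. i < D \<Longrightarrow> x i = y i"
    then show "same_label j x y" unfolding same_label_def using ext by blast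
  next
    fix j x y assume "same_label j x x" "same_label j y y"
      and near: "\<And>i. i < D \<Longrightarrow> \<bar>x i - y i\<bar> \<le> 2"
    then obtain W W' where "label j x W" "label j y W'" by (auto simp: same_label_def)
    moreover from this have "W = W'" using near by (rule label_near_eq)
    ultimately show "same_label j x y" by (auto simp: same_label_def)
  qed
  obtain x where x: "\<forall>j<D. \<not> same_label j x x" using not_covering by blast
  obtain j W where "j < D" "label j x W" using label_exists by blast
  then show False using x by (auto simp: same_label_def)
qed

end

section \<open>Weighted trees\<close>

lemma rtrancl_imp_distinct_path:
  assumes "(x, y) \<in> r\<^sup>*"
  shows "\<exists>p. p \<noteq> [] \<and> distinct p \<and> hd p = x \<and> last p = y \<and>
    (\<forall>i. Suc i < length p \<longrightarrow> (p ! i, p ! Suc i) \<in> r)"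
  using assms
proof (induction rule: rtrancl_induct)
  case base
  show ?case by (rule exI[of _ "[x]"]) simp
next
  case (step y z)
  then obtain p where p: "p \<noteq> []" "distinct p" "hd p = x" "last p = y"
      "\<And>i. Suc i < length p \<Longrightarrow> (p ! i, p ! Suc i) \<in> r"
    by blast
  show ?case
  proof (cases "z \<in> set p")
    case True
    then obtain j where j: "j < length p" "p ! j = z" by (auto simp: in_set_conv_nth)
    let ?q = "take (Suc j) p"
    have "last ?q = z" using j by (simp add: take_Suc_conv_app_nth)
    moreover have "(?q ! i, ?q ! Suc i) \<in> r" if "Suc i < length ?q" for i
      using that p(5)[of i] by simp
    ultimately show ?thesis using p j by (intro exI[of _ ?q]) auto
  next
    case False
    let ?q = "p @ [z]"
    have "(?q ! i, ?q ! Suc i) \<in> r" if "Suc i < length ?q" for i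
    proof (cases "Suc i < length p")
      case True
      then show ?thesis using p(5)[of i] by (simp add: nth_append)
    next
      case 2: False
      then have "i = length p - 1" "Suc i = length p" using that p(1) by auto
      then show ?thesis using step(2) p(1,4) by (simp add: nth_append last_conv_nth)
    qed
    then show ?thesis using p False by (intro exI[of _ ?q]) auto
  qed
qed

text \<open>Edges are added one at a time: by acyclicity a new edge joins two components, and the potential
  on one of them is shifted to fit.\<close>

lemma acyclic_potential_exists:
  fixes P :: "'a \<Rightarrow> 'a \<Rightarrow> 'b::ab_group_add \<Rightarrow> bool"
  assumes graph: "graph_on X T" and acyclic: "\<nexists>p. is_cycle X T p"
    and P: "\<And>x y. {x, y} \<in> edges T \<Longrightarrow> \<exists>t. P x y t"
    and P_sym: "\<And>x y t. P x y t \<Longrightarrow> P y x (- t)"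
    and "finite E" "E \<subseteq> edges T"
  shows "\<exists>h. \<forall>x y. {x, y} \<in> E \<longrightarrow> P x y (h y - h x)"
  using \<open>finite E\<close> \<open>E \<subseteq> edges T\<close>
proof (induction E rule: finite_induct)
  case empty
  show ?case by simp
next
  case (insert e E)
  then obtain h where h: "\<And>x y. {x, y} \<in> E \<Longrightarrow> P x y (h y - h x)" by auto
  have eT: "e \<in> edges T" and ET: "E \<subseteq> edges T" using insert.prems by auto
  obtain a b where ab: "a \<in> X" "b \<in> X" "a \<noteq> b" "e = {a, b}"
    using graph eT unfolding graph_on_def by blast
  obtain t where t: "P a b t" using P eT ab(4) by blast
  define r where "r = {(x, y). {x, y} \<in> E}"
  \<comment> \<open>The new edge would close a distinct path from \<open>b\<close> to
    \<open>a\<close> into a cycle; the path has at least three vertices because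
    \<open>{a, b}\<close> is not in \<open>E\<close>.\<close>
  have "(b, a) \<notin> r\<^sup>*"
  proof
    assume "(b, a) \<in> r\<^sup>*"
    then obtain p where p: "p \<noteq> []" "distinct p" "hd p = b" "last p = a"
        "\<And>i. Suc i < length p \<Longrightarrow> {p ! i, p ! Suc i} \<in> E"
      using rtrancl_imp_distinct_path[of b a r] unfolding r_def by auto
    have "length p \<noteq> 1" using p(3,4) ab(3) by (auto simp: length_Suc_conv)
    moreover have "length p \<noteq> 2"
    proof
      assume len: "length p = 2"
      then have "p ! 0 = b" "p ! 1 = a"
        using p(1,3,4) by (auto simp: hd_conv_nth last_conv_nth)
      then have "{b, a} \<in> E" using p(5)[of 0] len by simp
      then show False using insert.hyps(2) ab(4) by (simp add: insert_commute)
    qed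
    moreover have "length p \<noteq> 0" using p(1) by simp
    ultimately have "3 \<le> length p" by linarith
    moreover have "set p \<subseteq> X"
    proof
      fix x assume "x \<in> set p"
      then obtain i where i: "i < length p" "p ! i = x" by (auto simp: in_set_conv_nth)
      show "x \<in> X"
      proof (cases i)
        case 0
        then show ?thesis using i p(1,3) ab(2) by (simp add: hd_conv_nth)
      next
        case (Suc i')
        then have "{p ! i', x} \<in> edges T" using p(5)[of i'] i ET by auto
        then obtain u v where "u \<in> X" "v \<in> X" "{p ! i', x} = {u, v}"
          using graph unfolding graph_on_def by blast
        then show ?thesis by (auto simp: doubleton_eq_iff)
      qed
    qed
    moreover have "{last p, hd p} \<in> edges T" using p(3,4) ab(4) eT by simp
    ultimately have "is_cycle X T p"
      unfolding is_cycle_def is_walk_def using p(1,2,5) ET by auto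
    then show False using acyclic by blast
  qed
  then have a: "a \<notin> r\<^sup>* `` {b}" by blast
  \<comment> \<open>Shifting the component of \<open>b\<close> by this amount makes the difference
    across the new edge exactly \<open>t\<close>.\<close>
  define c where "c = h a + t - h b"
  define h' where "h' y = (if y \<in> r\<^sup>* `` {b} then h y + c else h y)" for y
  have "P x y (h' y - h' x)" if xy: "{x, y} \<in> insert e E" for x y
  proof (cases "{x, y} = e")
    case True
    have "h' b - h' a = t" using a by (simp add: h'_def c_def)
    then have "P a b (h' b - h' a)" "P b a (h' a - h' b)"
      using t P_sym[OF t] by auto
    then show ?thesis using True ab(4) by (auto simp: doubleton_eq_iff)
  next
    case False
    then have E: "{x, y} \<in> E" "{y, x} \<in> E" using xy by (auto simp: insert_commute)
    then have "(x, y) \<in> r" "(y, x) \<in> r" by (auto simp: r_def)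
    then have "x \<in> r\<^sup>* `` {b} \<longleftrightarrow> y \<in> r\<^sup>* `` {b}"
      using rtrancl_into_rtrancl[of b x r y] rtrancl_into_rtrancl[of b y r x] by blast
    then have "h' y - h' x = h y - h x" by (simp add: h'_def)
    then show ?thesis using h[OF E(1)] by simp
  qed
  then show ?case by blast
qed

section \<open>Tree distances and edge weights\<close>

lemma walk_weight_nonneg:
  assumes "\<And>e. e \<in> edges T \<Longrightarrow> 0 < weight T e" "is_walk X T p"
  shows "0 \<le> walk_weight T p"
  unfolding walk_weight_def
  by (rule sum_nonneg) (use assms in \<open>auto simp: is_walk_def less_imp_le\<close>)

lemma graph_dist_le_weight:
  assumes "weighted_tree_on X T" "{x, y} \<in> edges T"
  shows "graph_dist X T x y \<le> weight T {x, y}"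
proof -
  have "\<exists>u\<in>X. \<exists>v\<in>X. u \<noteq> v \<and> {x, y} = {u, v}"
    using assms unfolding weighted_tree_on_def graph_on_def by blast
  then have "x \<in> X" "y \<in> X" "x \<noteq> y" by (auto simp: doubleton_eq_iff)
  then have "is_path_between X T x [x, y] y"
    using assms(2) by (auto simp: is_path_between_def is_walk_def less_Suc_eq)
  then have "walk_weight T [x, y] \<in> {walk_weight T p | p. is_path_between X T x p y}" by blast
  moreover have "bdd_below {walk_weight T p | p. is_path_between X T x p y}"
    using walk_weight_nonneg[of T X] assms(1)
    by (intro bdd_belowI[of _ 0]) (auto simp: weighted_tree_on_def is_path_between_def)
  ultimately have "graph_dist X T x y \<le> walk_weight T [x, y]"
    unfolding graph_dist_def by (rule cInf_lower)
  then show ?thesis by (simp add: walk_weight_def)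
qed

text \<open>Telescoping along a path extends the bound from edges to all pairs.\<close>

lemma abs_diff_le_graph_dist:
  fixes g :: "'a \<Rightarrow> real"
  assumes tree: "weighted_tree_on X T" and "x \<in> X" "y \<in> X"
    and g: "\<And>u v. {u, v} \<in> edges T \<Longrightarrow> \<bar>g v - g u\<bar> \<le> weight T {u, v}"
  shows "\<bar>g y - g x\<bar> \<le> graph_dist X T x y"
  unfolding graph_dist_def
proof (rule cInf_greatest)
  show "{walk_weight T p | p. is_path_between X T x p y} \<noteq> {}"
    using tree \<open>x \<in> X\<close> \<open>y \<in> X\<close> unfolding weighted_tree_on_def connected_graph_def by auto
next
  fix w assume "w \<in> {walk_weight T p | p. is_path_between X T x p y}"
  then obtain p where w: "w = walk_weight T p" and p: "is_path_between X T x p y" by blast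
  have ne: "p \<noteq> []" and xy: "x = p ! 0" "y = p ! (length p - 1)"
    using p by (auto simp: is_path_between_def is_walk_def hd_conv_nth last_conv_nth)
  have "g y - g x = (\<Sum>i<length p - 1. g (p ! Suc i) - g (p ! i))"
    unfolding xy using sum_lessThan_telescope[of "\<lambda>i. g (p ! i)" "length p - 1"] by simp
  also have "\<bar>\<dots>\<bar> \<le> (\<Sum>i<length p - 1. \<bar>g (p ! Suc i) - g (p ! i)\<bar>)"
    by (rule sum_abs)
  also have "\<dots> \<le> walk_weight T p"
    unfolding walk_weight_def
    by (rule sum_mono, rule g) (use p in \<open>auto simp: is_path_between_def is_walk_def\<close>)
  finally show "\<bar>g y - g x\<bar> \<le> w" by (simp add: w)
qed

section \<open>The torus metric and its tree covers\<close>

text \<open>Only countably many reals are roots of nonzero integer polynomials. Powers of such a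
  number embed the deck group into the reals.\<close>

lemma exists_transcendental:
  "\<exists>\<theta>::real. \<forall>n. \<forall>v::nat \<Rightarrow> int. (\<Sum>i<n. of_int (v i) * \<theta> ^ i) = 0 \<longrightarrow> (\<forall>i<n. v i = 0)"
proof -
  define Z where "Z vs = {z::real. (\<Sum>i<length vs. of_int (vs ! i) * z ^ i) = 0}" for vs :: "int list"
  define N where "N = {vs :: int list. \<exists>i<length vs. vs ! i \<noteq> 0}"
  have "finite (Z vs)" if vs: "vs \<in> N" for vs
  proof -
    obtain i where i: "i < length vs" "vs ! i \<noteq> 0" using vs by (auto simp: N_def)
    have "{..<length vs} = {..length vs - 1}" using i(1) by auto
    then show ?thesis
      using i polyfun_roots_finite[of "\<lambda>i. real_of_int (vs ! i)" i "length vs - 1"]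
      by (auto simp: Z_def)
  qed
  then have "countable (\<Union>vs\<in>N. Z vs)"
    by (intro countable_UN) (auto intro: countable_finite)
  then obtain \<theta> where \<theta>: "\<theta> \<notin> (\<Union>vs\<in>N. Z vs)"
    using uncountable_UNIV_real by (metis UNIV_eq_I)
  have "v i = 0" if "(\<Sum>i<n. of_int (v i) * \<theta> ^ i) = 0" "i < n" for n i and v :: "nat \<Rightarrow> int"
  proof (rule ccontr)
    assume "v i \<noteq> 0"
    then have "map v [0..<n] \<in> N" using that(2) by (auto simp: N_def)
    moreover have "\<theta> \<in> Z (map v [0..<n])" using that(1) by (simp add: Z_def)
    ultimately show False using \<theta> by blast
  qed
  then show ?thesis by blast
qed

section \<open>Cyclic distance and the torus metric\<close>

definition circ :: "int \<Rightarrow> int \<Rightarrow> int" where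
  "circ m z = min (z mod m) ((- z) mod m)"

text \<open>Together with \<open>circ_attained\<close> this identifies \<open>circ m z\<close> as
  the distance from \<open>z\<close> to the nearest multiple of \<open>m\<close>.\<close>

lemma circ_le:
  assumes "0 < m" shows "circ m z \<le> \<bar>z + m * t\<bar>"
proof (cases "0 \<le> z + m * t")
  case True
  have "z mod m = (z + m * t) mod m" by simp
  also have "\<dots> \<le> z + m * t" using True by (rule zmod_le_nonneg_dividend)
  finally show ?thesis by (simp add: circ_def)
next
  case False
  have "(- z) mod m = (- (z + m * t)) mod m"
    by (metis mod_minus_cong mod_mult_self2)
  also have "\<dots> \<le> - (z + m * t)" using False by (intro zmod_le_nonneg_dividend) simp
  finally show ?thesis by (simp add: circ_def)
qed

lemma circ_attained:
  assumes "0 < m" shows "\<exists>t. circ m z = \<bar>z + m * t\<bar>"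
proof -
  have "circ m z = \<bar>z + m * - (z div m)\<bar> \<or> circ m z = \<bar>z + m * ((- z) div m)\<bar>"
    using assms pos_mod_sign[of m z] pos_mod_sign[of m "- z"]
      minus_mult_div_eq_mod[of z m] minus_mult_div_eq_mod[of "- z" m]
    unfolding circ_def min_def by (smt (verit) mult_minus_right)
  then show ?thesis by blast
qed

lemma circ_minus: "circ m (- z) = circ m z"
  by (simp add: circ_def min.commute)

lemma circ_triangle:
  assumes "0 < m" shows "circ m (y + z) \<le> circ m y + circ m z"
proof -
  obtain s t where "circ m y = \<bar>y + m * s\<bar>" "circ m z = \<bar>z + m * t\<bar>"
    using circ_attained[OF assms] by blast
  moreover have "circ m (y + z) \<le> \<bar>(y + z) + m * (s + t)\<bar>"
    by (rule circ_le[OF assms])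
  ultimately show ?thesis by (simp add: algebra_simps)
qed

text \<open>The map \<open>\<pi>\<close> to the torus need not be injective: distinct points with the same image get distance 1.
  This accommodates values of \<open>n\<close> that are not \<open>D\<close>-th powers.\<close>

definition torus_dist :: "nat \<Rightarrow> int \<Rightarrow> ('a \<Rightarrow> nat \<Rightarrow> int) \<Rightarrow> 'a \<Rightarrow> 'a \<Rightarrow> int" where
  "torus_dist D m \<pi> x y =
     (if x = y then 0 else Max (insert 1 ((\<lambda>i. circ m (\<pi> x i - \<pi> y i)) ` {..<D})))"

lemma torus_dist_le:
  assumes "\<And>i. i < D \<Longrightarrow> circ m (\<pi> x i - \<pi> y i) \<le> r" "1 \<le> r"
  shows "torus_dist D m \<pi> x y \<le> r"
  using assms by (auto simp: torus_dist_def)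

lemma torus_dist_ge_1: "x \<noteq> y \<Longrightarrow> 1 \<le> torus_dist D m \<pi> x y"
  by (simp add: torus_dist_def Max_ge_iff)

lemma circ_le_torus_dist: "i < D \<Longrightarrow> circ m (\<pi> x i - \<pi> y i) \<le> torus_dist D m \<pi> x y"
  by (auto simp: torus_dist_def circ_def intro: Max_ge)

lemma torus_dist_commute: "torus_dist D m \<pi> x y = torus_dist D m \<pi> y x"
proof -
  have "circ m (\<pi> x i - \<pi> y i) = circ m (\<pi> y i - \<pi> x i)" for i
    using circ_minus[of m "\<pi> x i - \<pi> y i"] by simp
  then show ?thesis by (auto simp: torus_dist_def)
qed

lemma Metric_space_torus_dist:
  assumes "0 < m"
  shows "Metric_space X (\<lambda>x y. real_of_int (torus_dist D m \<pi> x y))"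
proof
  fix x y z
  have nonneg: "0 \<le> torus_dist D m \<pi> x y" for x y
    using torus_dist_ge_1[of x y D m \<pi>] by (cases "x = y") (simp add: torus_dist_def, linarith)
  then show "0 \<le> real_of_int (torus_dist D m \<pi> x y)" by simp
  show "real_of_int (torus_dist D m \<pi> x y) = real_of_int (torus_dist D m \<pi> y x)"
    by (simp add: torus_dist_commute)
  show "real_of_int (torus_dist D m \<pi> x y) = 0 \<longleftrightarrow> x = y"
  proof
    assume "real_of_int (torus_dist D m \<pi> x y) = 0"
    then show "x = y" using torus_dist_ge_1[of x y D m \<pi>] by linarith
  qed (simp add: torus_dist_def)
  have "torus_dist D m \<pi> x z \<le> torus_dist D m \<pi> x y + torus_dist D m \<pi> y z"
  proof (cases "x = y \<or> y = z")
    case True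
    then show ?thesis by (auto simp: torus_dist_def)
  next
    case False
    show ?thesis
    proof (rule torus_dist_le)
      show "1 \<le> torus_dist D m \<pi> x y + torus_dist D m \<pi> y z"
        using False torus_dist_ge_1[of x y D m \<pi>] nonneg[of y z] by simp
      fix i assume "i < D"
      then show "circ m (\<pi> x i - \<pi> z i) \<le> torus_dist D m \<pi> x y + torus_dist D m \<pi> y z"
        using circ_triangle[OF assms, of "\<pi> x i - \<pi> y i" "\<pi> y i - \<pi> z i"]
          circ_le_torus_dist[of i D m \<pi> x y] circ_le_torus_dist[of i D m \<pi> y z] by simp
    qed
  qed
  then show "real_of_int (torus_dist D m \<pi> x z) \<le>
      real_of_int (torus_dist D m \<pi> x y) + real_of_int (torus_dist D m \<pi> y z)"
    by linarith
qed

text \<open>Across each edge, coordinate \<open>i\<close> has a lifted difference of size at most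
  the torus distance, hence at most the edge weight by domination. Acyclicity makes these choices
  consistent, and the Lipschitz bound extends from edges to tree distances.\<close>

lemma tree_lift_exists:
  assumes m: "0 < m" and "finite X" and tree: "weighted_tree_on X T" and i: "i < D"
    and dom: "\<And>x y. x \<in> X \<Longrightarrow> y \<in> X \<Longrightarrow> real_of_int (torus_dist D m \<pi> x y) \<le> graph_dist X T x y"
  shows "\<exists>h. \<forall>x\<in>X. \<forall>y\<in>X.
    real_of_int \<bar>(\<pi> y i + m * h y) - (\<pi> x i + m * h x)\<bar> \<le> graph_dist X T x y"
proof -
  have graph: "graph_on X T" and acyclic: "\<nexists>p. is_cycle X T p"
    using tree by (auto simp: weighted_tree_on_def)
  have "edges T \<subseteq> Pow X" using graph by (fastforce simp: graph_on_def)
  then have fin: "finite (edges T)" using \<open>finite X\<close> finite_subset by blast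
  define P where "P x y t \<longleftrightarrow> \<bar>\<pi> y i - \<pi> x i + m * t\<bar> \<le> torus_dist D m \<pi> x y" for x y t
  have "\<exists>t. P x y t" for x y
  proof -
    obtain t where "circ m (\<pi> y i - \<pi> x i) = \<bar>\<pi> y i - \<pi> x i + m * t\<bar>"
      using circ_attained[OF m] by blast
    then show ?thesis
      using circ_le_torus_dist[OF i, of m \<pi> y x] torus_dist_commute[of D m \<pi> y x]
      unfolding P_def by metis
  qed
  moreover have "P y x (- t)" if "P x y t" for x y t
  proof -
    have "\<bar>\<pi> x i - \<pi> y i + m * (- t)\<bar> = \<bar>\<pi> y i - \<pi> x i + m * t\<bar>"
      by (simp add: algebra_simps abs_if)
    then show ?thesis using that torus_dist_commute[of D m \<pi> y x] by (simp add: P_def)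
  qed
  ultimately obtain h where h: "\<And>x y. {x, y} \<in> edges T \<Longrightarrow> P x y (h y - h x)"
    using acyclic_potential_exists[OF graph acyclic _ _ fin order_refl, of P] by blast
  define g where "g x = real_of_int (\<pi> x i + m * h x)" for x
  have edge: "\<bar>g y - g x\<bar> \<le> weight T {x, y}" if xy: "{x, y} \<in> edges T" for x y
  proof -
    have "x \<in> X" "y \<in> X" using \<open>edges T \<subseteq> Pow X\<close> xy by auto
    have "\<bar>g y - g x\<bar> = real_of_int \<bar>\<pi> y i - \<pi> x i + m * (h y - h x)\<bar>"
      by (simp add: g_def algebra_simps)
    also have "\<dots> \<le> real_of_int (torus_dist D m \<pi> x y)"
      using h[OF xy] by (simp only: P_def of_int_le_iff)
    also have "\<dots> \<le> graph_dist X T x y" by (rule dom) fact+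
    also have "\<dots> \<le> weight T {x, y}" by (rule graph_dist_le_weight[OF tree xy])
    finally show ?thesis .
  qed
  have "real_of_int \<bar>(\<pi> y i + m * h y) - (\<pi> x i + m * h x)\<bar> \<le> graph_dist X T x y"
    if "x \<in> X" "y \<in> X" for x y
    using abs_diff_le_graph_dist[OF tree that edge] by (simp add: g_def)
  then show ?thesis by blast
qed

text \<open>For larger \<open>m\<close>, two points of the universal cover within
  \<open>4 * D\<close> lie on the same sheet of some tree's lift, since the sheets differ by a
  multiple of \<open>m\<close> of size below \<open>m\<close>. This contradicts
  \<open>equivariant_maps.inconsistent\<close>.\<close>

lemma torus_tree_cover_stretch:
  fixes m :: int
  assumes k: "1 \<le> k" and D: "D = 2 ^ (k - 1)" and m: "0 < m" and "finite X"
    and surj: "\<And>x. \<exists>q\<in>X. \<forall>i<D. \<pi> q i = x i mod m"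
    and cover: "tree_cover X (\<lambda>x y. real_of_int (torus_dist D m \<pi> x y)) \<alpha> k T"
  shows "real_of_int m \<le> 4 * real D * (\<alpha> + 1)"
proof (rule ccontr)
  assume small: "\<not> ?thesis"
  have \<alpha>: "1 \<le> \<alpha>" and tree: "\<And>a. a \<in> {1..k} \<Longrightarrow> weighted_tree_on X (T a)"
    and dom: "\<And>a x y. a \<in> {1..k} \<Longrightarrow> x \<in> X \<Longrightarrow> y \<in> X \<Longrightarrow>
      real_of_int (torus_dist D m \<pi> x y) \<le> graph_dist X (T a) x y"
    and stretch: "\<And>x y. x \<in> X \<Longrightarrow> y \<in> X \<Longrightarrow>
      \<exists>a\<in>{1..k}. graph_dist X (T a) x y \<le> \<alpha> * real_of_int (torus_dist D m \<pi> x y)"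
    using cover by (auto simp: tree_cover_def)
  have "\<exists>h. \<forall>x\<in>X. \<forall>y\<in>X. real_of_int \<bar>(\<pi> y i + m * h y) - (\<pi> x i + m * h x)\<bar>
      \<le> graph_dist X (T a) x y" if "a \<in> {1..k}" "i < D" for a i
    by (rule tree_lift_exists[OF m \<open>finite X\<close> tree[OF that(1)] that(2) dom[OF that(1)]])
  then obtain h where h: "\<And>a i x y. a \<in> {1..k} \<Longrightarrow> i < D \<Longrightarrow> x \<in> X \<Longrightarrow> y \<in> X \<Longrightarrow>
      real_of_int \<bar>(\<pi> y i + m * h a i y) - (\<pi> x i + m * h a i x)\<bar> \<le> graph_dist X (T a) x y"
    by metis
  obtain \<theta> :: real where \<theta>: "\<And>n (v :: nat \<Rightarrow> int) i.
      (\<Sum>i<n. of_int (v i) * \<theta> ^ i) = 0 \<Longrightarrow> i < n \<Longrightarrow> v i = 0"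
    using exists_transcendental by blast
  define q where "q x = (SOME q. q \<in> X \<and> (\<forall>i<D. \<pi> q i = x i mod m))" for x
  have q: "q x \<in> X" "\<And>i. i < D \<Longrightarrow> \<pi> (q x) i = x i mod m" for x
    using someI_ex[of "\<lambda>q. q \<in> X \<and> (\<forall>i<D. \<pi> q i = x i mod m)"] surj[of x]
    unfolding q_def by blast+
  define \<tau> where "\<tau> v = (\<Sum>i<D. of_int (v i) * \<theta> ^ i)" for v :: "nat \<Rightarrow> int"
  \<comment> \<open>\<open>\<psi> a x\<close> is the deck transformation carrying the lift of
    \<open>q x\<close> along the tree to \<open>x\<close>. The \<open>Suc\<close> reconciles trees
    numbered from 1 with maps numbered from 0.\<close>
  define \<psi> where "\<psi> a x i = x i div m - h (Suc a) i (q x)" for a x i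
  have "equivariant_maps k D m (\<lambda>a x. \<tau> (\<psi> a x)) \<tau>"
  proof
    show "1 \<le> k" "D = 2 ^ (k - 1)" "0 < m" by fact+
  next
    fix a x and v :: "nat \<Rightarrow> int"
    have "q (\<lambda>i. x i + m * v i) = q x" by (simp add: q_def)
    moreover have "(x i + m * v i) div m = x i div m + v i" for i
      using m by simp
    ultimately have "\<psi> a (\<lambda>i. x i + m * v i) i = \<psi> a x i + v i" for i
      by (simp add: \<psi>_def)
    then show "\<tau> (\<psi> a (\<lambda>i. x i + m * v i)) = \<tau> (\<psi> a x) + \<tau> v"
      by (simp add: \<tau>_def algebra_simps sum.distrib)
  next
    fix v i assume "\<tau> v = 0" "i < D"
    then show "v i = 0" unfolding \<tau>_def by (rule \<theta>)
  next
    fix x y :: "nat \<Rightarrow> int"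
    assume near: "\<And>i. i < D \<Longrightarrow> \<bar>x i - y i\<bar> \<le> 4 * int D"
    have "torus_dist D m \<pi> (q x) (q y) \<le> 4 * int D"
    proof (rule torus_dist_le)
      fix i assume i: "i < D"
      have "circ m (x i mod m - y i mod m) \<le> \<bar>(x i mod m - y i mod m) + m * (x i div m - y i div m)\<bar>"
        by (rule circ_le[OF m])
      also have "(x i mod m - y i mod m) + m * (x i div m - y i div m) = x i - y i"
        using mult_div_mod_eq[of m "x i"] mult_div_mod_eq[of m "y i"]
        by (simp only: right_diff_distrib)
      finally show "circ m (\<pi> (q x) i - \<pi> (q y) i) \<le> 4 * int D"
        using near[OF i] q(2)[OF i] by simp
    next
      have "0 < D" using D by simp
      then show "1 \<le> 4 * int D" by linarith
    qed
    then have d: "real_of_int (torus_dist D m \<pi> (q x) (q y)) \<le> 4 * real D" by linarith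
    obtain a where a: "a \<in> {1..k}"
        "graph_dist X (T a) (q y) (q x) \<le> \<alpha> * real_of_int (torus_dist D m \<pi> (q y) (q x))"
      using stretch[OF q(1) q(1)] by blast
    have dist: "graph_dist X (T a) (q y) (q x) \<le> \<alpha> * (4 * real D)"
    proof -
      have "\<alpha> * real_of_int (torus_dist D m \<pi> (q y) (q x)) \<le> \<alpha> * (4 * real D)"
        using d \<alpha> torus_dist_commute[of D m \<pi> "q y" "q x"] by (intro mult_left_mono) auto
      then show ?thesis using a(2) by linarith
    qed
    have "\<psi> (a - 1) x i = \<psi> (a - 1) y i" if i: "i < D" for i
    proof -
      have Suc: "Suc (a - 1) = a" using a(1) by simp
      let ?g = "\<lambda>q. \<pi> q i + m * h a i q"
      have "m * (\<psi> (a - 1) x i - \<psi> (a - 1) y i) = (x i - y i) - (?g (q x) - ?g (q y))"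
        using mult_div_mod_eq[of m "x i"] mult_div_mod_eq[of m "y i"]
        unfolding \<psi>_def Suc q(2)[OF i] by (simp add: algebra_simps)
      then have "real_of_int \<bar>m * (\<psi> (a - 1) x i - \<psi> (a - 1) y i)\<bar>
          \<le> real_of_int \<bar>x i - y i\<bar> + real_of_int \<bar>?g (q x) - ?g (q y)\<bar>"
        by linarith
      also have "\<dots> \<le> 4 * real D + \<alpha> * (4 * real D)"
        using near[OF i] h[OF a(1) i q(1)[of y] q(1)[of x]] dist by linarith
      also have "\<dots> < real_of_int m" using small by (simp add: algebra_simps)
      finally have "\<bar>m * (\<psi> (a - 1) x i - \<psi> (a - 1) y i)\<bar> < m * 1" by linarith
      then have "\<bar>\<psi> (a - 1) x i - \<psi> (a - 1) y i\<bar> < 1"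
        using m unfolding abs_mult by (simp add: mult_less_cancel_left)
      then show ?thesis by simp
    qed
    then have "\<tau> (\<psi> (a - 1) x) = \<tau> (\<psi> (a - 1) y)" unfolding \<tau>_def by simp
    then show "\<exists>a<k. \<tau> (\<psi> a x) = \<tau> (\<psi> a y)" using a(1) by (intro exI[of _ "a - 1"]) auto
  qed
  then show False by (rule equivariant_maps.inconsistent)
qed

theorem theorem1:
  fixes k :: nat
  assumes "1 \<le> k"
  shows "\<exists>c::real. 0 < c \<and>
    (\<forall>n::nat. 1 \<le> n \<longrightarrow>
      (\<exists>(X :: nat set) (d :: nat \<Rightarrow> nat \<Rightarrow> real).
         Metric_space X d \<and> finite X \<and> card X = n \<and>
         (\<forall>(\<alpha>::real) (T :: nat \<Rightarrow> nat wgraph).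
            tree_cover X d \<alpha> k T \<longrightarrow> c * real n powr (1 / 2 ^ (k - 1)) \<le> \<alpha>)))"
proof -
  define D :: nat where "D = 2 ^ (k - 1)"
  have D: "1 \<le> D" by (simp add: D_def)
  have "\<exists>(X :: nat set) (d :: nat \<Rightarrow> nat \<Rightarrow> real).
         Metric_space X d \<and> finite X \<and> card X = n \<and>
         (\<forall>(\<alpha>::real) (T :: nat \<Rightarrow> nat wgraph).
            tree_cover X d \<alpha> k T \<longrightarrow> 1 / (16 * real D) * real n powr (1 / 2 ^ (k - 1)) \<le> \<alpha>)"
    if n: "1 \<le> n" for n
  proof -
    define r where "r = real n powr (1 / real D)"
    have "1 \<le> r" unfolding r_def using n by (intro ge_one_powr_ge_zero) auto
    \<comment> \<open>Rounding down ensures \<open>m ^ D \<le> n\<close>, so that \<open>n\<close>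
      points can cover the torus; as \<open>r\<close> is at least 1, it costs at most a factor
      2.\<close>
    define m where "m = nat \<lfloor>r\<rfloor>"
    have m: "1 \<le> m" "real m \<le> r" "r \<le> 2 * real m"
    proof -
      have "1 \<le> \<lfloor>r\<rfloor>" using \<open>1 \<le> r\<close> by simp
      then have "real m = of_int \<lfloor>r\<rfloor>" "1 \<le> m" by (simp_all add: m_def le_nat_iff)
      then show "1 \<le> m" "real m \<le> r" "r \<le> 2 * real m" by linarith+
    qed
    have "real m ^ D \<le> r ^ D" using m(2) by (rule power_mono) simp
    also have "r ^ D = real n"
      using n D by (simp add: r_def powr_realpow[symmetric] powr_powr)
    finally have mn: "m ^ D \<le> n" by (metis of_nat_le_iff of_nat_power)
    define A where "A = ({..<D} \<rightarrow>\<^sub>E {0..<int m})"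
    have A: "finite A" "card A = m ^ D"
      by (simp_all add: A_def card_PiE finite_PiE)
    \<comment> \<open>The first \<open>m ^ D\<close> numbers enumerate the torus; any remaining
      points of \<open>X\<close> go wherever \<open>f\<close> sends them.\<close>
    obtain f where f: "bij_betw f {0..<m ^ D} A"
      using ex_bij_betw_nat_finite[OF A(1)] unfolding A(2) by (elim exE)
    have surj: "\<exists>q\<in>{..<n}. \<forall>i<D. f q i = x i mod int m" for x
    proof -
      have "restrict (\<lambda>i. x i mod int m) {..<D} \<in> A" using m(1) by (auto simp: A_def)
      then obtain q where "q < m ^ D" "f q = restrict (\<lambda>i. x i mod int m) {..<D}"
        unfolding bij_betw_imp_surj_on[OF f, symmetric] by auto
      then show ?thesis using mn by (intro bexI[of _ q]) simp_all
    qed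
    let ?d = "\<lambda>x y. real_of_int (torus_dist D (int m) f x y)"
    have "1 / (16 * real D) * real n powr (1 / 2 ^ (k - 1)) \<le> \<alpha>"
      if cover: "tree_cover {..<n} ?d \<alpha> k T" for \<alpha> and T :: "nat \<Rightarrow> nat wgraph"
    proof -
      have "real m \<le> 4 * real D * (\<alpha> + 1)"
        using torus_tree_cover_stretch[OF assms D_def _ _ surj cover] m(1) by simp
      \<comment> \<open>\<open>1 \<le> \<alpha>\<close> gives
        \<open>\<alpha> + 1 \<le> 2 * \<alpha>\<close>; with \<open>r \<le> 2 * m\<close> this makes
        the constant 16.\<close>
      also have "\<dots> \<le> 4 * real D * (2 * \<alpha>)"
        using cover by (intro mult_left_mono) (auto simp: tree_cover_def)
      finally have "r \<le> \<alpha> * (16 * real D)" using m(3) by (simp add: algebra_simps)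
      then have "r / (16 * real D) \<le> \<alpha>" using D by (simp add: divide_le_eq)
      then show ?thesis by (simp add: r_def D_def)
    qed
    moreover have "Metric_space {..<n} ?d"
      using m(1) by (intro Metric_space_torus_dist) simp
    ultimately show ?thesis
      by (intro exI[of _ "{..<n}"] exI[of _ ?d] conjI allI impI) simp_all
  qed
  then show ?thesis
    using D by (intro exI[of _ "1 / (16 * real D)"] conjI allI impI) simp_all
qed

end
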